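(* Let $X$ be a topological space. Then $X$ is $e^*$-$R_1$ if and only if for each $e^*$-open set $A$ of $X$ and each $x\in A$, $e^*\text{-}cl_\theta(\{x\})\subseteq A$.
   Context: No separation axioms are assumed on topological spaces. For a subset $A$ of a topological space $X$, $cl(A)$ and $int(A)$ denote closure and interior, and $\delta\text{-}cl(A)=\{x\in X : int(cl(U))\cap A\neq\emptyset \text{ for every open } U \ni x\}$. $A$ is $e^*$-open if $A\subseteq cl(int(\delta\text{-}cl(A)))$; $e^*$-closed if its complement is $e^*$-open. $e^*\text{-}cl(A)$ is the intersection of all $e^*$-closed sets containing $A$. The $e^*$-$\theta$-closure of $A$ is $e^*\text{-}cl_\theta(A)=\{x\in X : e^*\text{-}cl(U)\cap A\neq\emptyset \text{ for every } e^*\text{-open } U\ni x\}$. The space $X$ is $e^*$-$R_1$ if for all $x,y\in X$ with $e^*\text{-}cl(\{x\})\neq e^*\text{-}cl(\{y\})$ there exist disjoint $e^*$-open sets $U$ and $V$ with $e^*\text{-}cl(\{x\})\subseteq U$ and $e^*\text{-}cl(\{y\})\subseteq V$. *)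

theory Defs
  imports "HOL-Analysis.Abstract_Topology"
begin

text \<open>
  Subsets of a space \<open>X\<close> are sets contained in \<open>topspace X\<close>; complements are taken relative
  to \<open>topspace X\<close>. All operators below are meant for arguments contained in \<open>topspace X\<close>.
\<close>

definition delta_closure_of :: "'a topology \<Rightarrow> 'a set \<Rightarrow> 'a set" where
  "delta_closure_of X A =
     {x \<in> topspace X. \<forall>U. openin X U \<and> x \<in> U \<longrightarrow> X interior_of (X closure_of U) \<inter> A \<noteq> {}}"

definition e_star_open :: "'a topology \<Rightarrow> 'a set \<Rightarrow> bool" where
  "e_star_open X A \<longleftrightarrow>
     A \<subseteq> topspace X \<and> A \<subseteq> X closure_of (X interior_of (delta_closure_of X A))"

definition e_star_closed :: "'a topology \<Rightarrow> 'a set \<Rightarrow> bool" where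
  "e_star_closed X A \<longleftrightarrow> A \<subseteq> topspace X \<and> e_star_open X (topspace X - A)"

text \<open>
  The empty set is \<open>e\<^sup>*\<close>-open, so for \<open>A \<subseteq> topspace X\<close> the intersected family contains
  \<open>topspace X\<close> and is never empty.
\<close>

definition e_star_closure_of :: "'a topology \<Rightarrow> 'a set \<Rightarrow> 'a set" where
  "e_star_closure_of X A = \<Inter> {C. e_star_closed X C \<and> A \<subseteq> C}"

definition e_star_theta_closure_of :: "'a topology \<Rightarrow> 'a set \<Rightarrow> 'a set" where
  "e_star_theta_closure_of X A =
     {x \<in> topspace X. \<forall>U. e_star_open X U \<and> x \<in> U \<longrightarrow> e_star_closure_of X U \<inter> A \<noteq> {}}"

definition e_star_R1_space :: "'a topology \<Rightarrow> bool" where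
  "e_star_R1_space X \<longleftrightarrow>
     (\<forall>x \<in> topspace X. \<forall>y \<in> topspace X.
        e_star_closure_of X {x} \<noteq> e_star_closure_of X {y} \<longrightarrow>
        (\<exists>U V. e_star_open X U \<and> e_star_open X V \<and> disjnt U V \<and>
               e_star_closure_of X {x} \<subseteq> U \<and> e_star_closure_of X {y} \<subseteq> V))"

end

theory Submission
  imports Defs
begin

text \<open>
  Membership in the \<open>\<theta>\<close>-closure of a point is a separation statement: \<open>y\<close> fails to lie in
  the \<open>\<theta>\<close>-closure of \<open>{x}\<close> exactly when \<open>x\<close> and \<open>y\<close> have disjoint \<open>e\<^sup>*\<close>-open
  neighbourhoods (lemma \<open>in_e_star_theta_closure_of_singleton\<close>).

  If \<open>X\<close> is \<open>e\<^sup>*\<close>-\<open>R\<^sub>1\<close> and an \<open>e\<^sup>*\<close>-open set \<open>A\<close> contains \<open>x\<close> but not \<open>y\<close>, then the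
  complement of \<open>A\<close> shows that \<open>x\<close> is not in the closure of \<open>{y}\<close>; the two closures differ,
  so the points can be separated and \<open>y\<close> is not in the \<open>\<theta>\<close>-closure of \<open>{x}\<close>.

  Conversely, if the closures of \<open>{x}\<close> and \<open>{y}\<close> differ, some \<open>e\<^sup>*\<close>-open set contains one of
  the points but not the other, and the condition on \<open>\<theta>\<close>-closures yields disjoint
  \<open>e\<^sup>*\<close>-open neighbourhoods \<open>U\<close> and \<open>V\<close> of \<open>x\<close> and \<open>y\<close>. The same condition, applied to \<open>U\<close>
  and \<open>V\<close> themselves, makes them swallow the closures of the points, because the closure of a
  point lies in its \<open>\<theta>\<close>-closure.
\<close>

lemma e_star_open_subset_topspace: "e_star_open X A \<Longrightarrow> A \<subseteq> topspace X"
  by (simp add: e_star_open_def)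

lemma e_star_closed_topspace: "e_star_closed X (topspace X)"
  by (simp add: e_star_closed_def e_star_open_def)

lemma e_star_closed_Diff: "e_star_open X A \<Longrightarrow> e_star_closed X (topspace X - A)"
  by (simp add: e_star_closed_def double_diff e_star_open_subset_topspace)

lemma e_star_closure_of_subset_topspace:
  "A \<subseteq> topspace X \<Longrightarrow> e_star_closure_of X A \<subseteq> topspace X"
  using e_star_closed_topspace by (auto simp: e_star_closure_of_def)

lemma subset_e_star_closure_of: "A \<subseteq> e_star_closure_of X A"
  by (auto simp: e_star_closure_of_def)

lemma e_star_closure_of_minimal:
  "e_star_closed X C \<Longrightarrow> A \<subseteq> C \<Longrightarrow> e_star_closure_of X A \<subseteq> C"
  by (auto simp: e_star_closure_of_def)

lemma in_e_star_closure_of: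
  assumes "x \<in> topspace X" "A \<subseteq> topspace X"
  shows "x \<in> e_star_closure_of X A \<longleftrightarrow> (\<forall>V. e_star_open X V \<and> x \<in> V \<longrightarrow> V \<inter> A \<noteq> {})"
proof
  assume cl: "x \<in> e_star_closure_of X A"
  show "\<forall>V. e_star_open X V \<and> x \<in> V \<longrightarrow> V \<inter> A \<noteq> {}"
  proof (intro allI impI notI)
    fix V assume "e_star_open X V \<and> x \<in> V" and "V \<inter> A = {}"
    then have "e_star_closure_of X A \<subseteq> topspace X - V"
      using assms(2) by (intro e_star_closure_of_minimal e_star_closed_Diff) auto
    then show False
      using cl \<open>e_star_open X V \<and> x \<in> V\<close> by blast
  qed
next
  assume meets: "\<forall>V. e_star_open X V \<and> x \<in> V \<longrightarrow> V \<inter> A \<noteq> {}"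
  have "x \<in> C" if "e_star_closed X C" "A \<subseteq> C" for C
    using meets[rule_format, of "topspace X - C"] that assms(1)
    by (auto simp: e_star_closed_def)
  then show "x \<in> e_star_closure_of X A"
    by (simp add: e_star_closure_of_def)
qed

text \<open>
  The closure of a neighbourhood \<open>U\<close> of \<open>y\<close> misses \<open>x\<close> precisely when some \<open>e\<^sup>*\<close>-open
  neighbourhood of \<open>x\<close> misses \<open>U\<close>, so the asymmetric definition is in fact symmetric in the
  two points.
\<close>

lemma in_e_star_theta_closure_of_singleton:
  assumes "x \<in> topspace X" "y \<in> topspace X"
  shows "y \<in> e_star_theta_closure_of X {x} \<longleftrightarrow>
    \<not> (\<exists>U V. e_star_open X U \<and> e_star_open X V \<and> disjnt U V \<and> x \<in> U \<and> y \<in> V)"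
proof -
  have "x \<in> e_star_closure_of X V \<longleftrightarrow>
      \<not> (\<exists>U. e_star_open X U \<and> disjnt U V \<and> x \<in> U)" if "e_star_open X V" for V
    using in_e_star_closure_of[OF assms(1) e_star_open_subset_topspace[OF that]]
    by (auto simp: disjnt_def)
  then show ?thesis
    using assms(2) by (auto simp: e_star_theta_closure_of_def)
qed

lemma e_star_closure_of_subset_theta_closure_of:
  assumes "A \<subseteq> topspace X"
  shows "e_star_closure_of X A \<subseteq> e_star_theta_closure_of X A"
proof
  fix z assume z: "z \<in> e_star_closure_of X A"
  then have top: "z \<in> topspace X"
    using e_star_closure_of_subset_topspace[OF assms] by blast
  have "e_star_closure_of X U \<inter> A \<noteq> {}" if "e_star_open X U" "z \<in> U" for U
    using z in_e_star_closure_of[OF top assms] that subset_e_star_closure_of[of U X] by blast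
  then show "z \<in> e_star_theta_closure_of X A"
    using top by (simp add: e_star_theta_closure_of_def)
qed

text \<open>
  Points whose closures differ are distinguished by an \<open>e\<^sup>*\<close>-open set: if each point lay in the
  closure of the other, each closure would contain the other.
\<close>

lemma e_star_closure_of_singleton_neqE:
  assumes "x \<in> topspace X" "y \<in> topspace X"
    and "e_star_closure_of X {x} \<noteq> e_star_closure_of X {y}"
  obtains A where "e_star_open X A" "x \<in> A \<longleftrightarrow> y \<notin> A"
proof -
  have "x \<notin> e_star_closure_of X {y} \<or> y \<notin> e_star_closure_of X {x}"
    using assms(3) by (auto simp: e_star_closure_of_def)
  then show thesis
    using that in_e_star_closure_of[of x X "{y}"] in_e_star_closure_of[of y X "{x}"] assms(1,2)
    by auto
qed

theorem theorem6p5: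
  fixes X :: "'a topology"
  shows "e_star_R1_space X \<longleftrightarrow>
    (\<forall>A. e_star_open X A \<longrightarrow> (\<forall>x \<in> A. e_star_theta_closure_of X {x} \<subseteq> A))"
proof
  assume R1: "e_star_R1_space X"
  show "\<forall>A. e_star_open X A \<longrightarrow> (\<forall>x \<in> A. e_star_theta_closure_of X {x} \<subseteq> A)"
  proof (intro allI impI ballI subsetI, rule ccontr)
    fix A x y
    assume A: "e_star_open X A" "x \<in> A" "y \<notin> A" and y: "y \<in> e_star_theta_closure_of X {x}"
    have top: "x \<in> topspace X" "y \<in> topspace X"
      using A e_star_open_subset_topspace y by (auto simp: e_star_theta_closure_of_def)
    have "x \<notin> e_star_closure_of X {y}"
      using in_e_star_closure_of[of x X "{y}"] A top by auto
    then have "e_star_closure_of X {x} \<noteq> e_star_closure_of X {y}"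
      using subset_e_star_closure_of[of "{x}" X] by blast
    then obtain U V where "e_star_open X U" "e_star_open X V" "disjnt U V"
        "e_star_closure_of X {x} \<subseteq> U" "e_star_closure_of X {y} \<subseteq> V"
      using R1 top unfolding e_star_R1_space_def by meson
    then show False
      using y in_e_star_theta_closure_of_singleton[OF top]
        subset_e_star_closure_of[of "{x}" X] subset_e_star_closure_of[of "{y}" X]
      by blast
  qed
next
  assume theta: "\<forall>A. e_star_open X A \<longrightarrow> (\<forall>x \<in> A. e_star_theta_closure_of X {x} \<subseteq> A)"
  have closure_subset: "e_star_closure_of X {x} \<subseteq> U" if "e_star_open X U" "x \<in> U" for x U
    using theta that e_star_closure_of_subset_theta_closure_of[of "{x}" X]
      e_star_open_subset_topspace[of X U] by blast
  show "e_star_R1_space X"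
    unfolding e_star_R1_space_def
  proof (intro ballI impI)
    fix x y
    assume top: "x \<in> topspace X" "y \<in> topspace X"
      and "e_star_closure_of X {x} \<noteq> e_star_closure_of X {y}"
    then obtain A where "e_star_open X A" "x \<in> A \<longleftrightarrow> y \<notin> A"
      by (rule e_star_closure_of_singleton_neqE)
    then have "y \<notin> e_star_theta_closure_of X {x} \<or> x \<notin> e_star_theta_closure_of X {y}"
      using theta by blast
    \<comment> \<open>Either alternative separates the points, by the symmetry of the relation.\<close>
    then obtain U V where "e_star_open X U" "e_star_open X V" "disjnt U V" "x \<in> U" "y \<in> V"
      using in_e_star_theta_closure_of_singleton[OF top]
        in_e_star_theta_closure_of_singleton[OF top(2,1)] disjnt_sym by metis
    then show "\<exists>U V. e_star_open X U \<and> e_star_open X V \<and> disjnt U V \<and>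
        e_star_closure_of X {x} \<subseteq> U \<and> e_star_closure_of X {y} \<subseteq> V"
      using closure_subset by blast
  qed
qed

end
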